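(* Let $1\le d<d_Z$ and $p\ge1$ be integers, let $\tau>0$, and let $G_\theta:\mathbb{R}^d\times\mathbb{R}^{d_Z-d}\to\mathbb{R}^p$ be a map. Let $u$ be a random vector in $\mathbb{R}^d$ with finite second moment, mean $m_u$ and covariance $\Sigma_u$, and assume $G_\theta$ is differentiable at $(m_u,0)$. Let $\eta\sim\mathcal{N}(0,I_d)$ and $z_{\mathrm{rec}}\sim\mathcal{N}(0,I_{d_Z-d})$ with $(u,\eta,z_{\mathrm{rec}})$ independent, and set $z_{\mathrm{aux}}:=u+\tau\eta$. Let $J_{\mathrm{aux}}\in\mathbb{R}^{p\times d}$ and $J_{\mathrm{rec}}\in\mathbb{R}^{p\times(d_Z-d)}$ be the Jacobians of $G_\theta$ with respect to its first and second argument at $(m_u,0)$, and let $$x_{\mathrm{lin}}:=G_\theta(m_u,0)+J_{\mathrm{aux}}(z_{\mathrm{aux}}-m_u)+J_{\mathrm{rec}}z_{\mathrm{rec}}.$$ Let $J_{\mathrm{aux}}=Q_{\mathrm{aux}}R_{\mathrm{aux}}$ and $J_{\mathrm{rec}}=Q_{\mathrm{rec}}R_{\mathrm{rec}}$ be QR decompositions, where $Q_{\mathrm{aux}}\in\mathbb{R}^{p\times r_{\mathrm{aux}}}$ and $Q_{\mathrm{rec}}\in\mathbb{R}^{p\times r_{\mathrm{rec}}}$ have orthonormal columns spanning $\operatorname{range}(J_{\mathrm{aux}})$ and $\operatorname{range}(J_{\mathrm{rec}})$ respectively. Define $$x_{\mathrm{aux}}:=Q_{\mathrm{aux}}^\top(x_{\mathrm{lin}}-\mathbb{E}[x_{\mathrm{lin}}]),\qquad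 x_{\mathrm{rec}}:=Q_{\mathrm{rec}}^\top(x_{\mathrm{lin}}-\mathbb{E}[x_{\mathrm{lin}}]),$$ and $\rho:=\|Q_{\mathrm{aux}}^\top Q_{\mathrm{rec}}\|_2$. Then $\rho\in[0,1]$ and $$\bigl\|\mathrm{Cov}(x_{\mathrm{aux}},x_{\mathrm{rec}})\bigr\|_2\le\rho\,\Bigl(\bigl\|R_{\mathrm{aux}}(\Sigma_u+\tau^2I_d)R_{\mathrm{aux}}^\top\bigr\|_2+\bigl\|R_{\mathrm{rec}}R_{\mathrm{rec}}^\top\bigr\|_2\Bigr).$$ In particular, if $\operatorname{range}(J_{\mathrm{aux}})$ and $\operatorname{range}(J_{\mathrm{rec}})$ are orthogonal (so $\rho=0$), then the covariance of $(x_{\mathrm{aux}},x_{\mathrm{rec}})$ is block diagonal, i.e. $\mathrm{Cov}(x_{\mathrm{aux}},x_{\mathrm{rec}})=0$; and if they are approximately orthogonal (small $\rho$), it is approximately block diagonal in the sense of the displayed bound.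
   Context: $\|\cdot\|_2$ is the spectral (operator) norm of a matrix. For square-integrable random vectors $a,b$, $\mathrm{Cov}(a,b):=\mathbb{E}[(a-\mathbb{E}a)(b-\mathbb{E}b)^\top]$. *)

theory Defs
  imports "HOL-Probability.Probability"
begin

(* The ranks r_aux, r_rec are zero when a Jacobian vanishes, so they cannot be cardinalities of
   index types. A matrix with such a dimension is therefore indexed by nat with explicit bounds:
   a p x r matrix is given by its columns "nat \<Rightarrow> real^'p", an r x n matrix by its rows
   "nat \<Rightarrow> real^'n", and an r x s matrix by its entries "nat \<Rightarrow> nat \<Rightarrow> real". *)

(* Largest Euclidean norm of A x over |x| <= 1. Using the unit ball instead of the unit sphere
   gives the value 0 when r = 0 or s = 0. *)
definition spectral_norm :: "nat \<Rightarrow> nat \<Rightarrow> (nat \<Rightarrow> nat \<Rightarrow> real) \<Rightarrow> real" where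
  "spectral_norm r s A =
     (SUP x \<in> {x. L2_set x {..<s} \<le> 1}. L2_set (\<lambda>k. \<Sum>l<s. A k l * x l) {..<r})"

(* Reduced (rank-revealing) QR factorisation J = Q R with r columns q_k in Q and rows r_k in R.
   Triangularity of R with respect to some order of the columns is not demanded: the index type
   'n carries no order, and nothing here depends on it. Hence every QR decomposition, with or
   without column pivoting, is covered. *)
definition thin_qr ::
    "nat \<Rightarrow> (nat \<Rightarrow> real^'p) \<Rightarrow> (nat \<Rightarrow> real^'n) \<Rightarrow> real^'n^'p \<Rightarrow> bool" where
  "thin_qr r Q R J \<longleftrightarrow>
     (\<forall>k<r. \<forall>l<r. Q k \<bullet> Q l = (if k = l then 1 else 0)) \<and>
     span (Q ` {..<r}) = range (\<lambda>v. J *v v) \<and>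
     (\<forall>i j. J $ i $ j = (\<Sum>k<r. Q k $ i * R k $ j))"

definition covar :: "'a measure \<Rightarrow> ('a \<Rightarrow> real) \<Rightarrow> ('a \<Rightarrow> real) \<Rightarrow> real" where
  "covar M f g = (LINT \<omega>|M. (f \<omega> - (LINT \<omega>'|M. f \<omega>')) * (g \<omega> - (LINT \<omega>'|M. g \<omega>')))"

definition cov_matrix :: "'a measure \<Rightarrow> ('a \<Rightarrow> real^'n) \<Rightarrow> real^'n^'n" where
  "cov_matrix M u = (\<chi> i j. covar M (\<lambda>\<omega>. u \<omega> $ i) (\<lambda>\<omega>. u \<omega> $ j))"

definition cross_cov ::
    "'a measure \<Rightarrow> ('a \<Rightarrow> nat \<Rightarrow> real) \<Rightarrow> ('a \<Rightarrow> nat \<Rightarrow> real) \<Rightarrow> nat \<Rightarrow> nat \<Rightarrow> real" where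
  "cross_cov M a b k l = covar M (\<lambda>\<omega>. a \<omega> k) (\<lambda>\<omega>. b \<omega> l)"

(* X ~ N(0, I): the density (2 pi)^(-n/2) exp(-|x|^2/2) is a product of one-dimensional ones. *)
definition std_gaussian :: "'a measure \<Rightarrow> ('a \<Rightarrow> real^'n) \<Rightarrow> bool" where
  "std_gaussian M X \<longleftrightarrow>
     distributed M lborel X (\<lambda>x. ennreal (\<Prod>i\<in>UNIV. std_normal_density (x $ i)))"

(* Mutual independence of X, Y, Z. prob_space.indep_vars needs a common codomain type, so its
   definition is written out for three variables of different types. *)
definition indep_triple ::
    "'a measure \<Rightarrow> ('a \<Rightarrow> 'b::topological_space) \<Rightarrow> ('a \<Rightarrow> 'c::topological_space) \<Rightarrow>
     ('a \<Rightarrow> 'd::topological_space) \<Rightarrow> bool" where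
  "indep_triple M X Y Z \<longleftrightarrow>
     X \<in> borel_measurable M \<and> Y \<in> borel_measurable M \<and> Z \<in> borel_measurable M \<and>
     prob_space.indep_sets M
       (\<lambda>i::nat. if i = 0 then {X -` A \<inter> space M | A. A \<in> sets borel}
            else if i = 1 then {Y -` A \<inter> space M | A. A \<in> sets borel}
            else {Z -` A \<inter> space M | A. A \<in> sets borel})
       {0, 1, 2}"

end

theory Submission
  imports Defs
begin

text \<open>With \<open>w = z\<^sub>a\<^sub>u\<^sub>x - m\<^sub>u\<close>, \<open>K = \<Sigma>\<^sub>u + \<tau>\<^sup>2 I\<close> and \<open>S = Q\<^sub>a\<^sub>u\<^sub>x\<^sup>T Q\<^sub>r\<^sub>e\<^sub>c\<close>, the QR factorisations give
  \<open>x\<^sub>a\<^sub>u\<^sub>x = R\<^sub>a\<^sub>u\<^sub>x w + S R\<^sub>r\<^sub>e\<^sub>c z\<close> and \<open>x\<^sub>r\<^sub>e\<^sub>c = S\<^sup>T R\<^sub>a\<^sub>u\<^sub>x w + R\<^sub>r\<^sub>e\<^sub>c z\<close>. Independence makes \<open>w\<close> and \<open>z\<close>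
  uncorrelated with covariances \<open>K\<close> and \<open>I\<close>, so the cross covariance is
  \<open>(R\<^sub>a\<^sub>u\<^sub>x K R\<^sub>a\<^sub>u\<^sub>x\<^sup>T) S + S (R\<^sub>r\<^sub>e\<^sub>c R\<^sub>r\<^sub>e\<^sub>c\<^sup>T)\<close>. The bound follows from submultiplicativity of the spectral
  norm, and \<open>\<rho> \<le> 1\<close> from Bessel's inequality.\<close>

section \<open>Spectral norm of matrices with explicit bounds\<close>

text \<open>Cauchy-Schwarz on each row gives a crude bound, linear in the norm of \<open>x\<close>.
  It serves to show that the supremum defining \<open>spectral_norm\<close> is taken over a bounded
  set.\<close>

lemma L2_set_matrix_mult_le:
  "L2_set (\<lambda>k. \<Sum>l\<in>S. A k l * x l) R \<le> (\<Sum>k\<in>R. L2_set (A k) S) * L2_set x S"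
proof -
  have "\<bar>\<Sum>l\<in>S. A k l * x l\<bar> \<le> L2_set (A k) S * L2_set x S" for k
  proof -
    have "\<bar>\<Sum>l\<in>S. A k l * x l\<bar> \<le> (\<Sum>l\<in>S. \<bar>A k l\<bar> * \<bar>x l\<bar>)"
      by (metis (mono_tags, lifting) abs_mult sum.cong sum_abs)
    then show ?thesis
      using L2_set_mult_ineq[of "A k" x S] by linarith
  qed
  then have "(\<Sum>k\<in>R. \<bar>\<Sum>l\<in>S. A k l * x l\<bar>) \<le> (\<Sum>k\<in>R. L2_set (A k) S) * L2_set x S"
    by (simp add: sum_distrib_right sum_mono)
  then show ?thesis
    by (rule order_trans[OF L2_set_le_sum_abs])
qed

lemma spectral_norm_upper:
  assumes "L2_set x {..<s} \<le> 1"
  shows "L2_set (\<lambda>k. \<Sum>l<s. A k l * x l) {..<r} \<le> spectral_norm r s A"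
  unfolding spectral_norm_def
proof (rule cSUP_upper)
  show "bdd_above ((\<lambda>x. L2_set (\<lambda>k. \<Sum>l<s. A k l * x l) {..<r}) ` {x. L2_set x {..<s} \<le> 1})"
  proof (rule bdd_aboveI2)
    fix x assume x: "x \<in> {x. L2_set x {..<s} \<le> 1}"
    have "(\<Sum>k<r. L2_set (A k) {..<s}) * L2_set x {..<s} \<le> (\<Sum>k<r. L2_set (A k) {..<s}) * 1"
      using x by (intro mult_left_mono sum_nonneg) auto
    then show "L2_set (\<lambda>k. \<Sum>l<s. A k l * x l) {..<r} \<le> (\<Sum>k<r. L2_set (A k) {..<s})"
      using L2_set_matrix_mult_le[of A x "{..<s}" "{..<r}"] by linarith
  qed
qed (use assms in simp)

lemma spectral_norm_least:
  assumes "\<And>x. L2_set x {..<s} \<le> 1 \<Longrightarrow> L2_set (\<lambda>k. \<Sum>l<s. A k l * x l) {..<r} \<le> c"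
  shows "spectral_norm r s A \<le> c"
  unfolding spectral_norm_def
proof (rule cSUP_least)
  \<comment> \<open>The zero vector lies in the unit ball even for \<open>s = 0\<close>, so the
    supremum is never over the empty set.\<close>
  have "L2_set (\<lambda>_. 0) {..<s} \<le> (1::real)"
    by (simp add: L2_set_0')
  then show "{x. L2_set x {..<s} \<le> (1::real)} \<noteq> {}"
    by blast
qed (use assms in auto)

lemma spectral_norm_nonneg: "0 \<le> spectral_norm r s A"
  using spectral_norm_upper[of "\<lambda>_. 0" s A r] by (simp add: L2_set_0')

text \<open>Homogeneity: a nonzero \<open>x\<close> is rescaled to norm 1, where the definition
  applies, and the factor is moved back.\<close>

lemma spectral_norm_bound:
  "L2_set (\<lambda>k. \<Sum>l<s. A k l * x l) {..<r} \<le> spectral_norm r s A * L2_set x {..<s}"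
proof (cases "L2_set x {..<s} = 0")
  case True
  then have "\<forall>l<s. x l = 0"
    by (simp add: L2_set_eq_0_iff)
  then show ?thesis
    by (simp add: True L2_set_0')
next
  case False
  define c where "c = L2_set x {..<s}"
  have c: "c > 0"
    using False L2_set_nonneg[of x "{..<s}"] unfolding c_def by linarith
  have "L2_set (\<lambda>l. x l * (1/c)) {..<s} = 1"
    using c by (subst L2_set_left_distrib[symmetric]) (auto simp: c_def)
  then have "L2_set (\<lambda>k. \<Sum>l<s. A k l * (x l * (1/c))) {..<r} \<le> spectral_norm r s A"
    by (intro spectral_norm_upper) simp
  moreover have "L2_set (\<lambda>k. \<Sum>l<s. A k l * (x l * (1/c))) {..<r}
      = L2_set (\<lambda>k. \<Sum>l<s. A k l * x l) {..<r} * (1/c)"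
    using c by (subst L2_set_left_distrib) (auto simp: sum_divide_distrib)
  ultimately show ?thesis
    using c by (simp add: field_simps c_def)
qed

text \<open>Entries outside the \<open>r\<close> by \<open>s\<close> block are arbitrary values of a
  total function, so formulas valid only within the bounds can still be substituted.\<close>

lemma spectral_norm_cong:
  assumes "\<And>k l. k < r \<Longrightarrow> l < s \<Longrightarrow> A k l = B k l"
  shows "spectral_norm r s A = spectral_norm r s B"
  unfolding spectral_norm_def using assms
  by (intro SUP_cong refl L2_set_cong sum.cong) auto

lemma spectral_norm_zero: "spectral_norm r s (\<lambda>k l. 0) = 0"
  by (intro antisym spectral_norm_least spectral_norm_nonneg) (simp add: L2_set_0')

lemma spectral_norm_add_le:
  "spectral_norm r s (\<lambda>k l. A k l + B k l) \<le> spectral_norm r s A + spectral_norm r s B"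
proof (rule spectral_norm_least)
  fix x assume x: "L2_set x {..<s} \<le> (1::real)"
  have "L2_set (\<lambda>k. \<Sum>l<s. (A k l + B k l) * x l) {..<r}
      \<le> L2_set (\<lambda>k. \<Sum>l<s. A k l * x l) {..<r} + L2_set (\<lambda>k. \<Sum>l<s. B k l * x l) {..<r}"
    by (simp add: distrib_right sum.distrib L2_set_triangle_ineq)
  then show "L2_set (\<lambda>k. \<Sum>l<s. (A k l + B k l) * x l) {..<r}
      \<le> spectral_norm r s A + spectral_norm r s B"
    using spectral_norm_upper[OF x, of A r] spectral_norm_upper[OF x, of B r] by linarith
qed

text \<open>By associativity \<open>(A B) x = A (B x)\<close>. The bound for \<open>A\<close> holds
  at vectors of any length, so it applies directly to \<open>B x\<close>.\<close>

lemma spectral_norm_mult_le: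
  "spectral_norm r t (\<lambda>k m. \<Sum>l<s. A k l * B l m) \<le> spectral_norm r s A * spectral_norm s t B"
proof (rule spectral_norm_least)
  fix x assume x: "L2_set x {..<t} \<le> (1::real)"
  have "(\<Sum>m<t. (\<Sum>l<s. A k l * B l m) * x m) = (\<Sum>l<s. A k l * (\<Sum>m<t. B l m * x m))" for k
    unfolding sum_distrib_right sum_distrib_left by (subst sum.swap) (simp add: mult_ac)
  then have "L2_set (\<lambda>k. \<Sum>m<t. (\<Sum>l<s. A k l * B l m) * x m) {..<r}
      \<le> spectral_norm r s A * L2_set (\<lambda>l. \<Sum>m<t. B l m * x m) {..<s}"
    using spectral_norm_bound[of A "\<lambda>l. \<Sum>m<t. B l m * x m" s r] by simp
  also have "\<dots> \<le> spectral_norm r s A * spectral_norm s t B"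
    using spectral_norm_upper[OF x] spectral_norm_nonneg by (rule mult_left_mono)
  finally show "L2_set (\<lambda>k. \<Sum>m<t. (\<Sum>l<s. A k l * B l m) * x m) {..<r}
      \<le> spectral_norm r s A * spectral_norm s t B" .
qed

section \<open>Orthonormal families and QR factors\<close>

definition orthonormal_upto :: "nat \<Rightarrow> (nat \<Rightarrow> 'v::real_inner) \<Rightarrow> bool" where
  "orthonormal_upto r Q \<longleftrightarrow> (\<forall>k<r. \<forall>l<r. Q k \<bullet> Q l = (if k = l then 1 else 0))"

lemma orthonormal_inner_sum:
  assumes "orthonormal_upto r Q" and "k < r"
  shows "Q k \<bullet> (\<Sum>l<r. x l *\<^sub>R Q l) = x k"
proof -
  have "Q k \<bullet> (\<Sum>l<r. x l *\<^sub>R Q l) = (\<Sum>l<r. if k = l then x l else 0)"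
    unfolding inner_sum_right using assms
    by (intro sum.cong) (auto simp: orthonormal_upto_def)
  then show ?thesis
    using assms by simp
qed

text \<open>Pythagoras: the map from coefficients to combinations of an orthonormal family is an
  isometry.\<close>

lemma orthonormal_norm_sum:
  assumes "orthonormal_upto r Q"
  shows "norm (\<Sum>l<r. x l *\<^sub>R Q l) = L2_set x {..<r}"
proof -
  have "(\<Sum>l<r. x l *\<^sub>R Q l) \<bullet> (\<Sum>l<r. x l *\<^sub>R Q l) = (\<Sum>k<r. (x k)\<^sup>2)"
    unfolding inner_sum_left[of _ "{..<r}"]
    by (intro sum.cong) (auto simp: orthonormal_inner_sum[OF assms] power2_eq_square)
  then show ?thesis
    by (simp add: norm_eq_sqrt_inner L2_set_def)
qed

lemma bessel_inequality:
  assumes "orthonormal_upto r Q"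
  shows "L2_set (\<lambda>k. Q k \<bullet> y) {..<r} \<le> norm y"
proof -
  \<comment> \<open>The orthogonal projection of \<open>y\<close> onto the span of \<open>Q\<close>.
    Its inner product with \<open>y\<close> is its own squared norm, so Cauchy-Schwarz bounds its
    norm by that of \<open>y\<close>.\<close>
  define p where "p = (\<Sum>k<r. (Q k \<bullet> y) *\<^sub>R Q k)"
  have "p \<bullet> y = (\<Sum>k<r. (Q k \<bullet> y)\<^sup>2)"
    by (simp add: p_def inner_sum_left power2_eq_square)
  also have "\<dots> = (norm p)\<^sup>2"
    by (simp add: p_def orthonormal_norm_sum[OF assms] L2_set_def sum_nonneg)
  finally have "norm p * norm p \<le> norm p * norm y"
    using norm_cauchy_schwarz[of p y] by (simp add: power2_eq_square)
  then have "norm p \<le> norm y"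
    by (cases "norm p = 0") auto
  then show ?thesis
    by (simp add: p_def orthonormal_norm_sum[OF assms])
qed

text \<open>The matrix is a product of an isometry (synthesis with \<open>Q\<close>) and a
  contraction (analysis with \<open>P\<close>, by Bessel).\<close>

lemma spectral_norm_orthonormal_le_1:
  assumes "orthonormal_upto r P" and "orthonormal_upto s Q"
  shows "spectral_norm r s (\<lambda>k l. P k \<bullet> Q l) \<le> 1"
proof (rule spectral_norm_least)
  fix x assume x: "L2_set x {..<s} \<le> (1::real)"
  have "L2_set (\<lambda>k. \<Sum>l<s. (P k \<bullet> Q l) * x l) {..<r}
      = L2_set (\<lambda>k. P k \<bullet> (\<Sum>l<s. x l *\<^sub>R Q l)) {..<r}"
    by (simp add: inner_sum_right mult.commute)
  also have "\<dots> \<le> L2_set x {..<s}"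
    using bessel_inequality[OF assms(1)] by (simp flip: orthonormal_norm_sum[OF assms(2)])
  finally show "L2_set (\<lambda>k. \<Sum>l<s. (P k \<bullet> Q l) * x l) {..<r} \<le> 1"
    using x by linarith
qed

lemma thin_qr_mult_vec:
  assumes "thin_qr r Q R J"
  shows "J *v v = (\<Sum>k<r. (R k \<bullet> v) *\<^sub>R Q k)"
proof -
  have "(J *v v) $ i = (\<Sum>k<r. (R k \<bullet> v) *\<^sub>R Q k) $ i" for i
  proof -
    have "(J *v v) $ i = (\<Sum>j\<in>UNIV. \<Sum>k<r. Q k $ i * (R k $ j * v $ j))"
      using assms by (simp add: thin_qr_def matrix_vector_mult_def sum_distrib_right mult.assoc)
    also have "\<dots> = (\<Sum>k<r. Q k $ i * (R k \<bullet> v))"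
      by (subst sum.swap) (simp add: inner_vec_def sum_distrib_left)
    finally show ?thesis
      by (simp add: mult.commute)
  qed
  then show ?thesis
    by (simp add: vec_eq_iff)
qed

lemma thin_qr_orthonormal: "thin_qr r Q R J \<Longrightarrow> orthonormal_upto r Q"
  by (simp add: thin_qr_def orthonormal_upto_def)

text \<open>Carries orthogonality of the ranges of two Jacobians over to the columns of their QR
  factors.\<close>

lemma thin_qr_in_range: "thin_qr r Q R J \<Longrightarrow> k < r \<Longrightarrow> Q k \<in> range (\<lambda>v. J *v v)"
  unfolding thin_qr_def by (metis imageI lessThan_iff span_base)

section \<open>Integration of random vectors by components\<close>

lemma has_bochner_integral_vec:
  fixes X :: "'a \<Rightarrow> real^'n"
  assumes "\<And>i. has_bochner_integral M (\<lambda>\<omega>. X \<omega> $ i) (m $ i)"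
  shows "has_bochner_integral M X m"
proof -
  have expand: "x = (\<Sum>i\<in>UNIV. (x $ i) *\<^sub>R axis i 1)" for x :: "real^'n"
    using basis_expansion[of x] by (simp add: scalar_mult_eq_scaleR)
  have "has_bochner_integral M (\<lambda>\<omega>. \<Sum>i\<in>UNIV. (X \<omega> $ i) *\<^sub>R axis i (1::real))
      (\<Sum>i\<in>UNIV. (m $ i) *\<^sub>R axis i 1)"
    by (intro has_bochner_integral_sum has_bochner_integral_scaleR_left assms)
  then show ?thesis
    by (simp flip: expand)
qed

text \<open>A product of two linear functionals expands into the coordinate products, so their
  moments determine the result. The matrix \<open>K\<close> may be rectangular and need not be
  symmetric.\<close>

lemma has_bochner_integral_bilinear:
  fixes X :: "'a \<Rightarrow> real^'m" and Y :: "'a \<Rightarrow> real^'n"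
  assumes "\<And>i j. has_bochner_integral M (\<lambda>\<omega>. X \<omega> $ i * Y \<omega> $ j) (K $ i $ j)"
  shows "has_bochner_integral M (\<lambda>\<omega>. (a \<bullet> X \<omega>) * (b \<bullet> Y \<omega>)) (a \<bullet> (K *v b))"
proof -
  have "has_bochner_integral M (\<lambda>\<omega>. \<Sum>i\<in>UNIV. \<Sum>j\<in>UNIV. (a $ i * b $ j) * (X \<omega> $ i * Y \<omega> $ j))
      (\<Sum>i\<in>UNIV. \<Sum>j\<in>UNIV. (a $ i * b $ j) * K $ i $ j)"
    by (intro has_bochner_integral_sum has_bochner_integral_mult_right assms)
  moreover have "(a \<bullet> X \<omega>) * (b \<bullet> Y \<omega>)
      = (\<Sum>i\<in>UNIV. \<Sum>j\<in>UNIV. (a $ i * b $ j) * (X \<omega> $ i * Y \<omega> $ j))" for \<omega>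
    by (simp add: inner_vec_def sum_product mult_ac)
  moreover have "a \<bullet> (K *v b) = (\<Sum>i\<in>UNIV. \<Sum>j\<in>UNIV. (a $ i * b $ j) * K $ i $ j)"
    by (simp add: inner_vec_def matrix_vector_mult_def sum_distrib_left mult_ac)
  ultimately show ?thesis
    by simp
qed

section \<open>Product integrals and Gaussian moments\<close>

text \<open>Fubini for functions with separated variables. \<open>lborel\<close> on vectors is the
  image of a product measure indexed by \<open>Basis\<close>, so the work lies in passing between
  coordinates \<open>i\<close> and basis vectors \<open>axis i 1\<close>.\<close>

lemma has_bochner_integral_lborel_prod_vec:
  fixes f :: "'n::finite \<Rightarrow> real \<Rightarrow> real"
  assumes f: "\<And>i. has_bochner_integral lborel (f i) (c i)"
  shows "has_bochner_integral lborel (\<lambda>x::real^'n. \<Prod>i\<in>UNIV. f i (x $ i)) (\<Prod>i\<in>UNIV. c i)"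
proof -
  have inj: "inj (\<lambda>i::'n. axis i (1::real))"
    by (auto intro!: injI simp: axis_eq_axis)
  have Basis: "(Basis :: (real^'n) set) = range (\<lambda>i. axis i 1)"
    by (auto simp: Basis_vec_def)
  \<comment> \<open>The inverse of \<open>axis\<close> recovers the coordinate from the basis
    vector, which reindexes the factors by \<open>Basis\<close>.\<close>
  define g where "g b = f (inv (\<lambda>i. axis i (1::real)) b)" for b :: "real^'n"
  have g: "g (axis i 1) = f i" for i
    by (simp add: g_def inv_f_f[OF inj])
  interpret product_sigma_finite "\<lambda>_::real^'n. lborel :: real measure"
    by standard
  have meas [measurable]: "f i \<in> borel_measurable borel" for i
    using f[of i] borel_measurable_integrable[of lborel "f i"] by (simp add: has_bochner_integral_iff)
  have int: "integrable lborel (g b)" for b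
    using f by (auto simp: g_def has_bochner_integral_iff)
  have P: "has_bochner_integral (\<Pi>\<^sub>M b\<in>Basis. lborel) (\<lambda>x. \<Prod>b\<in>Basis. g b (x b)) (\<Prod>i\<in>UNIV. c i)"
    unfolding has_bochner_integral_iff
  proof
    show "integrable (\<Pi>\<^sub>M b\<in>Basis. lborel) (\<lambda>x. \<Prod>b\<in>Basis. g b (x b))"
      by (intro product_integrable_prod int) simp
    have "(\<integral>x. (\<Prod>b\<in>Basis. g b (x b)) \<partial>(\<Pi>\<^sub>M b\<in>Basis. lborel)) = (\<Prod>b\<in>Basis. integral\<^sup>L lborel (g b))"
      by (intro product_integral_prod int) simp
    also have "\<dots> = (\<Prod>i\<in>UNIV. c i)"
      using f unfolding Basis by (subst prod.reindex[OF inj]) (simp add: g has_bochner_integral_iff)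
    finally show "(\<integral>x. (\<Prod>b\<in>Basis. g b (x b)) \<partial>(\<Pi>\<^sub>M b\<in>Basis. lborel)) = (\<Prod>i\<in>UNIV. c i)" .
  qed
  have eq: "(\<Prod>i\<in>UNIV. f i ((\<Sum>b\<in>Basis. x b *\<^sub>R b) $ i)) = (\<Prod>b\<in>Basis. g b (x b))"
    for x :: "real^'n \<Rightarrow> real"
  proof -
    have "(\<Sum>b\<in>Basis. x b *\<^sub>R b) $ i = x (axis i 1)" for i
      unfolding Basis by (subst sum.reindex[OF inj]) (simp add: axis_def if_distrib cong: if_cong)
    then show ?thesis
      unfolding Basis by (subst prod.reindex[OF inj]) (simp add: g)
  qed
  show ?thesis
    \<comment> \<open>Removing \<open>sum_component\<close> keeps the simplifier from pushing the
      coordinate into the sum, which would hide the left-hand side of \<open>eq\<close>.\<close>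
    by (subst lborel_eq, rule has_bochner_integral_distr) (use P in \<open>simp_all add: eq del: sum_component\<close>)
qed

lemma std_normal_moment_0: "has_bochner_integral lborel std_normal_density 1"
  using std_normal_moment_even[of 0] by simp

lemma std_normal_moment_1: "has_bochner_integral lborel (\<lambda>x. std_normal_density x * x) 0"
  using std_normal_moment_odd[of 0] by simp

lemma std_normal_moment_2: "has_bochner_integral lborel (\<lambda>x. std_normal_density x * (x * x)) 1"
  using std_normal_moment_even[of 1] by (simp add: power2_eq_square)

text \<open>Density and integrand are both products over the coordinates, so the expectation factors
  into one-dimensional moments.\<close>

lemma std_gaussian_moment:
  fixes X :: "'a \<Rightarrow> real^'n"
  assumes X: "std_gaussian M X"
    and h: "\<And>b. has_bochner_integral lborel (\<lambda>x. std_normal_density x * h b x) (c b)"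
    and [measurable]: "\<And>b. h b \<in> borel_measurable borel"
  shows "has_bochner_integral M (\<lambda>\<omega>. \<Prod>b\<in>UNIV. h b (X \<omega> $ b)) (\<Prod>b\<in>UNIV. c b)"
proof -
  let ?f = "\<lambda>x::real^'n. \<Prod>i\<in>UNIV. std_normal_density (x $ i)"
  let ?g = "\<lambda>x::real^'n. \<Prod>b\<in>UNIV. h b (x $ b)"
  have D: "distributed M lborel X (\<lambda>x. ennreal (?f x))"
    using X by (simp add: std_gaussian_def)
  have g: "?g \<in> borel_measurable lborel"
    by measurable
  have nn: "0 \<le> ?f x" for x
    by (intro prod_nonneg) simp
  have "has_bochner_integral lborel (\<lambda>x. ?f x * ?g x) (\<Prod>b\<in>UNIV. c b)"
    using has_bochner_integral_lborel_prod_vec[OF h] by (simp add: prod.distrib)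
  then show ?thesis
    using distributed_integrable[OF D g nn] distributed_integral[OF D g nn]
    by (simp add: has_bochner_integral_iff)
qed

lemma std_gaussian_mean:
  fixes X :: "'a \<Rightarrow> real^'n"
  assumes "std_gaussian M X"
  shows "has_bochner_integral M (\<lambda>\<omega>. X \<omega> $ i) 0"
proof -
  \<comment> \<open>The factor is the identity at coordinate \<open>i\<close> and 1 elsewhere, so
    the product collapses to \<open>X \<omega> $ i\<close>.\<close>
  have "has_bochner_integral M (\<lambda>\<omega>. \<Prod>b\<in>UNIV. (\<lambda>x. if b = i then x else 1) (X \<omega> $ b))
      (\<Prod>b\<in>UNIV. if b = i then 0 else 1)"
    by (rule std_gaussian_moment[OF assms])
      (auto simp: std_normal_moment_0 std_normal_moment_1)
  then show ?thesis
    by (simp add: prod.delta)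
qed

lemma std_gaussian_second_moment:
  fixes X :: "'a \<Rightarrow> real^'n"
  assumes "std_gaussian M X"
  shows "has_bochner_integral M (\<lambda>\<omega>. X \<omega> $ i * X \<omega> $ j) (mat 1 $ i $ j)"
proof -
  \<comment> \<open>The factor at \<open>b\<close> is \<open>x * x\<close>, \<open>x\<close> or 1
    according to how many of \<open>i\<close>, \<open>j\<close> equal \<open>b\<close>. For
    \<open>i \<noteq> j\<close> a vanishing first moment occurs; for \<open>i = j\<close> all
    moments are 1.\<close>
  have "has_bochner_integral M
      (\<lambda>\<omega>. \<Prod>b\<in>UNIV. (\<lambda>x. (if b = i then x else 1) * (if b = j then x else 1)) (X \<omega> $ b))
      (\<Prod>b\<in>UNIV. if b = i \<and> b \<noteq> j then 0 else if b \<noteq> i \<and> b = j then 0 else 1)"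
    by (rule std_gaussian_moment[OF assms])
      (auto simp: std_normal_moment_0 std_normal_moment_1 std_normal_moment_2)
  moreover have "(\<Prod>b\<in>UNIV. if b = i \<and> b \<noteq> j then 0 else if b \<noteq> i \<and> b = j then 0 else 1)
      = (mat 1 $ i $ j :: real)"
    by (cases "i = j") (auto simp: mat_def intro!: prod.neutral prod_zero)
  ultimately show ?thesis
    by (simp add: prod.distrib prod.delta)
qed

section \<open>Independence of random vectors of different dimensions\<close>

lemma (in prob_space) indep_set_pairI:
  assumes indep: "indep_sets F I" and I: "i \<in> I" "j \<in> I" "i \<noteq> j"
  shows "indep_set (F i) (F j)"
proof (rule indep_setI)
  fix a b assume "a \<in> F i" "b \<in> F j"
  then show "prob (a \<inter> b) = prob a * prob b"
    using indep_setsD[OF indep, of "{i, j}" "\<lambda>k. if k = i then a else b"] I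
    by (auto simp: Int_commute)
qed (use assms in \<open>auto simp: indep_sets_def\<close>)

text \<open>The sigma-algebra generated by \<open>X\<close>, written in the form that occurs in
  \<open>indep_triple\<close>.\<close>

definition borel_events :: "'a measure \<Rightarrow> ('a \<Rightarrow> 'b::topological_space) \<Rightarrow> 'a set set" where
  "borel_events M X = {X -` A \<inter> space M | A. A \<in> sets borel}"

text \<open>Intersection stability permits the passage to generated sigma-algebras, the form in
  which \<open>indep_var\<close> is characterised.\<close>

lemma Int_stable_borel_events: "Int_stable (borel_events M X)"
proof (rule Int_stableI)
  fix a b assume "a \<in> borel_events M X" "b \<in> borel_events M X"
  then obtain A B where "A \<in> sets borel" "B \<in> sets borel"
    "a = X -` A \<inter> space M" "b = X -` B \<inter> space M"
    unfolding borel_events_def by blast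
  then have "a \<inter> b = X -` (A \<inter> B) \<inter> space M" "A \<inter> B \<in> sets borel"
    by auto
  then show "a \<inter> b \<in> borel_events M X"
    unfolding borel_events_def by blast
qed

lemma borel_events_comp:
  assumes "f \<in> borel_measurable borel"
  shows "borel_events M (\<lambda>\<omega>. f (X \<omega>)) \<subseteq> borel_events M X"
proof
  fix a assume "a \<in> borel_events M (\<lambda>\<omega>. f (X \<omega>))"
  then obtain A where "A \<in> sets borel" "a = (\<lambda>\<omega>. f (X \<omega>)) -` A \<inter> space M"
    unfolding borel_events_def by blast
  then have "a = X -` (f -` A) \<inter> space M" "f -` A \<in> sets borel"
    using measurable_sets_borel[OF assms] by auto
  then show "a \<in> borel_events M X"
    unfolding borel_events_def by blast
qed

text \<open>The codomains of \<open>X\<close> and \<open>Y\<close> may differ here, whereas \<^term>\<open>prob_space.indep_var\<close> requires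
  a common type; hence independence of the vectors is kept as independence of event systems.\<close>

lemma (in prob_space) indep_set_borel_events_comp:
  assumes indep: "indep_set (borel_events M X) (borel_events M Y)"
    and f: "f \<in> borel_measurable borel" and g: "g \<in> borel_measurable borel"
  shows "indep_set (borel_events M (\<lambda>\<omega>. f (X \<omega>))) (borel_events M (\<lambda>\<omega>. g (Y \<omega>)))"
  unfolding indep_set_def
  by (rule indep_sets_mono_sets[OF indep[unfolded indep_set_def]])
    (simp add: borel_events_comp f g split: bool.split)

lemma (in prob_space) indep_triple_indep_set:
  assumes "indep_triple M X Y Z"
  shows "indep_set (borel_events M X) (borel_events M Y)"
    and "indep_set (borel_events M X) (borel_events M Z)"
    and "indep_set (borel_events M Y) (borel_events M Z)"
proof -
  let ?F = "\<lambda>i::nat. if i = 0 then borel_events M X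
            else if i = 1 then borel_events M Y else borel_events M Z"
  have F: "indep_sets ?F {0, 1, 2}"
    using assms unfolding indep_triple_def borel_events_def by blast
  show "indep_set (borel_events M X) (borel_events M Y)"
    using indep_set_pairI[OF F, of 0 1] by simp
  show "indep_set (borel_events M X) (borel_events M Z)"
    using indep_set_pairI[OF F, of 0 2] by simp
  show "indep_set (borel_events M Y) (borel_events M Z)"
    using indep_set_pairI[OF F, of 1 2] by simp
qed

text \<open>Single coordinates are real-valued, hence share a codomain, so \<open>indep_var\<close>
  and its product rule for expectations become available.\<close>

lemma (in prob_space) indep_set_product_moment:
  fixes X :: "'a \<Rightarrow> real^'m" and Y :: "'a \<Rightarrow> real^'n"
  assumes indep: "indep_set (borel_events M X) (borel_events M Y)"
    and X: "has_bochner_integral M (\<lambda>\<omega>. X \<omega> $ i) a"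
    and Y: "has_bochner_integral M (\<lambda>\<omega>. Y \<omega> $ j) b"
  shows "has_bochner_integral M (\<lambda>\<omega>. X \<omega> $ i * Y \<omega> $ j) (a * b)"
proof -
  have "indep_set (borel_events M (\<lambda>\<omega>. X \<omega> $ i)) (borel_events M (\<lambda>\<omega>. Y \<omega> $ j))"
    by (rule indep_set_borel_events_comp[OF indep]) simp_all
  from indep_set_sigma_sets[OF this Int_stable_borel_events Int_stable_borel_events]
  have "indep_var borel (\<lambda>\<omega>. X \<omega> $ i) borel (\<lambda>\<omega>. Y \<omega> $ j)"
    unfolding indep_var_eq borel_events_def
    using X Y by (auto simp: has_bochner_integral_iff borel_measurable_integrable)
  from indep_var_lebesgue_integral[OF this] indep_var_integrable[OF this] X Y
  show ?thesis
    by (simp add: has_bochner_integral_iff)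
qed

section \<open>Centred moments and the cross covariance\<close>

lemma (in prob_space) centred_moments:
  fixes u :: "'a \<Rightarrow> real^'n"
  assumes u: "u \<in> borel_measurable M"
    and sq: "integrable M (\<lambda>\<omega>. (norm (u \<omega>))\<^sup>2)"
    and m: "m = (LINT \<omega>|M. u \<omega>)"
  shows "has_bochner_integral M (\<lambda>\<omega>. (u \<omega> - m) $ i) 0"
    and "has_bochner_integral M (\<lambda>\<omega>. (u \<omega> - m) $ i * (u \<omega> - m) $ j) (cov_matrix M u $ i $ j)"
proof -
  have [measurable]: "(\<lambda>\<omega>. u \<omega> $ i) \<in> borel_measurable M" for i
    by (rule measurable_compose[OF u]) simp
  have prod_int: "integrable M (\<lambda>\<omega>. u \<omega> $ i * u \<omega> $ j)" for i j
  proof (rule Bochner_Integration.integrable_bound[OF sq])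
    have "\<bar>x $ i * x $ j\<bar> \<le> (norm x)\<^sup>2" for x :: "real^'n"
      unfolding abs_mult power2_eq_square
      using component_le_norm_cart[of x] by (intro mult_mono) auto
    then show "AE \<omega> in M. norm (u \<omega> $ i * u \<omega> $ j) \<le> norm ((norm (u \<omega>))\<^sup>2)"
      by simp
  qed measurable
  \<comment> \<open>On a probability space square integrability implies integrability; the square is
    the case \<open>i = j\<close> of \<open>prod_int\<close>.\<close>
  have int: "integrable M (\<lambda>\<omega>. u \<omega> $ i)" for i
    by (rule square_integrable_imp_integrable) (use prod_int[of i i] in \<open>auto simp: power2_eq_square\<close>)
  \<comment> \<open>The mean \<open>m\<close> is a vector-valued integral, while
    \<open>covar\<close> uses means of coordinates; this identifies the two.\<close>
  have "has_bochner_integral M u (\<chi> i. LINT \<omega>|M. u \<omega> $ i)"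
    by (rule has_bochner_integral_vec) (use int in \<open>simp add: has_bochner_integral_iff\<close>)
  then have mi: "m $ i = (LINT \<omega>|M. u \<omega> $ i)" for i
    by (simp add: m has_bochner_integral_iff)
  show "has_bochner_integral M (\<lambda>\<omega>. (u \<omega> - m) $ i) 0"
    using int by (simp add: has_bochner_integral_iff mi prob_space)
  have "integrable M (\<lambda>\<omega>. (u \<omega> $ i - m $ i) * (u \<omega> $ j - m $ j))"
    using int prod_int by (simp add: algebra_simps)
  then show "has_bochner_integral M (\<lambda>\<omega>. (u \<omega> - m) $ i * (u \<omega> - m) $ j) (cov_matrix M u $ i $ j)"
    by (simp add: has_bochner_integral_iff cov_matrix_def covar_def mi)
qed

text \<open>Both projections of the centred \<open>x\<close> are linear in \<open>w\<close> and
  \<open>z\<close>. Since these are centred and uncorrelated, only the two pure terms survive,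
  giving an entry of \<open>A S + S B\<close> with \<open>A = R K R^T\<close>,
  \<open>S = Q^T Q'\<close> and \<open>B = R' R'^T\<close>.\<close>

lemma cross_cov_linear:
  fixes w :: "'a \<Rightarrow> real^'d" and z :: "'a \<Rightarrow> real^'e" and x :: "'a \<Rightarrow> real^'p"
  assumes "prob_space M"
    and qr: "thin_qr r Q R J" and qr': "thin_qr s Q' R' J'"
    and w: "\<And>i. has_bochner_integral M (\<lambda>\<omega>. w \<omega> $ i) 0"
    and z: "\<And>i. has_bochner_integral M (\<lambda>\<omega>. z \<omega> $ i) 0"
    and ww: "\<And>i j. has_bochner_integral M (\<lambda>\<omega>. w \<omega> $ i * w \<omega> $ j) (K $ i $ j)"
    and wz: "\<And>i j. has_bochner_integral M (\<lambda>\<omega>. w \<omega> $ i * z \<omega> $ j) 0"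
    and zz: "\<And>i j. has_bochner_integral M (\<lambda>\<omega>. z \<omega> $ i * z \<omega> $ j) (mat 1 $ i $ j)"
    and x: "x = (\<lambda>\<omega>. c + J *v w \<omega> + J' *v z \<omega>)"
    and kl: "k < r" "l < s"
  shows "cross_cov M (\<lambda>\<omega> k. Q k \<bullet> (x \<omega> - (LINT \<omega>'|M. x \<omega>')))
           (\<lambda>\<omega> k. Q' k \<bullet> (x \<omega> - (LINT \<omega>'|M. x \<omega>'))) k l
         = (\<Sum>i<r. (R k \<bullet> (K *v R i)) * (Q i \<bullet> Q' l)) + (\<Sum>j<s. (Q k \<bullet> Q' j) * (R' j \<bullet> R' l))"
proof -
  interpret prob_space M by fact
  have "has_bochner_integral M w 0" "has_bochner_integral M z 0"
    using w z by (auto intro!: has_bochner_integral_vec)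
  then have "has_bochner_integral M (\<lambda>\<omega>. J *v w \<omega> + J' *v z \<omega>) (J *v 0 + J' *v 0)"
    by (intro has_bochner_integral_add
        has_bochner_integral_bounded_linear[OF matrix_vector_mul_bounded_linear])
  then have y: "has_bochner_integral M (\<lambda>\<omega>. J *v w \<omega> + J' *v z \<omega>) 0"
    by simp
  then have "has_bochner_integral M x c"
    unfolding x by (auto simp: has_bochner_integral_iff add.assoc prob_space)
  then have centred: "x \<omega> - (LINT \<omega>'|M. x \<omega>') = J *v w \<omega> + J' *v z \<omega>" for \<omega>
    by (simp add: has_bochner_integral_iff x)
  have mean: "(LINT \<omega>|M. q \<bullet> (J *v w \<omega> + J' *v z \<omega>)) = 0" for q
    using has_bochner_integral_inner_right[OF y, of q] by (simp add: has_bochner_integral_iff)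
  \<comment> \<open>\<open>a\<close> is row \<open>l\<close> of \<open>S^T R\<close> and
    \<open>b\<close> is row \<open>k\<close> of \<open>S R'\<close>: the leakage of each component
    into the other projection.\<close>
  define a where "a = (\<Sum>i<r. (Q i \<bullet> Q' l) *\<^sub>R R i)"
  define b where "b = (\<Sum>j<s. (Q k \<bullet> Q' j) *\<^sub>R R' j)"
  have Q: "Q k \<bullet> (J *v w \<omega> + J' *v z \<omega>) = R k \<bullet> w \<omega> + b \<bullet> z \<omega>" for \<omega>
  proof -
    have "Q k \<bullet> (J' *v z \<omega>) = b \<bullet> z \<omega>"
      by (simp add: thin_qr_mult_vec[OF qr'] b_def inner_sum_left inner_sum_right mult.commute)
    then show ?thesis
      by (simp add: inner_add_right thin_qr_mult_vec[OF qr]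
          orthonormal_inner_sum[OF thin_qr_orthonormal[OF qr] kl(1)])
  qed
  have Q': "Q' l \<bullet> (J *v w \<omega> + J' *v z \<omega>) = a \<bullet> w \<omega> + R' l \<bullet> z \<omega>" for \<omega>
  proof -
    have "Q' l \<bullet> (J *v w \<omega>) = a \<bullet> w \<omega>"
      by (simp add: thin_qr_mult_vec[OF qr] a_def inner_sum_left inner_sum_right
          mult.commute inner_commute[of "Q' l"])
    then show ?thesis
      by (simp add: inner_add_right thin_qr_mult_vec[OF qr']
          orthonormal_inner_sum[OF thin_qr_orthonormal[OF qr'] kl(2)])
  qed
  have cross: "has_bochner_integral M (\<lambda>\<omega>. (p \<bullet> w \<omega>) * (q \<bullet> z \<omega>)) 0" for p q
    using has_bochner_integral_bilinear[of M w z "0::real^'e^'d" p q] wz by simp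
  \<comment> \<open>The four products of the expansion; in the third the \<open>w\<close> factor is
    put first so that \<open>cross\<close> applies.\<close>
  have "has_bochner_integral M
      (\<lambda>\<omega>. (R k \<bullet> w \<omega>) * (a \<bullet> w \<omega>) + (R k \<bullet> w \<omega>) * (R' l \<bullet> z \<omega>)
         + ((a \<bullet> w \<omega>) * (b \<bullet> z \<omega>) + (b \<bullet> z \<omega>) * (R' l \<bullet> z \<omega>)))
      (R k \<bullet> (K *v a) + 0 + (0 + b \<bullet> (mat 1 *v R' l)))"
    by (intro has_bochner_integral_add has_bochner_integral_bilinear cross ww zz)
  moreover have "(\<lambda>\<omega>. (R k \<bullet> w \<omega>) * (a \<bullet> w \<omega>) + (R k \<bullet> w \<omega>) * (R' l \<bullet> z \<omega>)
         + ((a \<bullet> w \<omega>) * (b \<bullet> z \<omega>) + (b \<bullet> z \<omega>) * (R' l \<bullet> z \<omega>)))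
      = (\<lambda>\<omega>. (R k \<bullet> w \<omega> + b \<bullet> z \<omega>) * (a \<bullet> w \<omega> + R' l \<bullet> z \<omega>))"
    by (simp add: algebra_simps)
  ultimately have "cross_cov M (\<lambda>\<omega> k. Q k \<bullet> (x \<omega> - (LINT \<omega>'|M. x \<omega>')))
        (\<lambda>\<omega> k. Q' k \<bullet> (x \<omega> - (LINT \<omega>'|M. x \<omega>'))) k l = R k \<bullet> (K *v a) + b \<bullet> R' l"
    unfolding cross_cov_def covar_def centred mean by (simp add: Q Q' has_bochner_integral_iff)
  moreover have "R k \<bullet> (K *v a) = (\<Sum>i<r. (R k \<bullet> (K *v R i)) * (Q i \<bullet> Q' l))"
    unfolding a_def linear_sum[OF matrix_vector_mul_linear]
    by (simp add: linear_cmul[OF matrix_vector_mul_linear] inner_sum_right mult.commute)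
  moreover have "b \<bullet> R' l = (\<Sum>j<s. (Q k \<bullet> Q' j) * (R' j \<bullet> R' l))"
    by (simp add: b_def inner_sum_left)
  ultimately show ?thesis
    by simp
qed

theorem corollary4p4:
  fixes M :: "'a measure"
    and G :: "(real^'d) \<times> (real^'e) \<Rightarrow> real^'p"
    and u \<eta> z_aux :: "'a \<Rightarrow> real^'d"
    and z_rec :: "'a \<Rightarrow> real^'e"
    and x_lin :: "'a \<Rightarrow> real^'p"
    and \<tau> \<rho> :: real
    and m_u :: "real^'d"
    and \<Sigma>_u :: "real^'d^'d"
    and J_aux :: "real^'d^'p"
    and J_rec :: "real^'e^'p"
    and r_aux r_rec :: nat
    and Q_aux Q_rec :: "nat \<Rightarrow> real^'p"
    and R_aux :: "nat \<Rightarrow> real^'d"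
    and R_rec :: "nat \<Rightarrow> real^'e"
    and x_aux x_rec :: "'a \<Rightarrow> nat \<Rightarrow> real"
  assumes "prob_space M"
    and "\<tau> > 0"
    and "u \<in> borel_measurable M"
    and "integrable M (\<lambda>\<omega>. (norm (u \<omega>))\<^sup>2)"
    and "m_u = (LINT \<omega>|M. u \<omega>)"
    and "\<Sigma>_u = cov_matrix M u"
    and "G differentiable (at (m_u, 0))"
    and "std_gaussian M \<eta>"
    and "std_gaussian M z_rec"
    and "indep_triple M u \<eta> z_rec"
    and "z_aux = (\<lambda>\<omega>. u \<omega> + \<tau> *\<^sub>R \<eta> \<omega>)"
    and "J_aux = jacobian (\<lambda>a. G (a, 0)) (at m_u)"
    and "J_rec = jacobian (\<lambda>b. G (m_u, b)) (at 0)"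
    and "x_lin = (\<lambda>\<omega>. G (m_u, 0) + J_aux *v (z_aux \<omega> - m_u) + J_rec *v z_rec \<omega>)"
    and "thin_qr r_aux Q_aux R_aux J_aux"
    and "thin_qr r_rec Q_rec R_rec J_rec"
    and "x_aux = (\<lambda>\<omega> k. Q_aux k \<bullet> (x_lin \<omega> - (LINT \<omega>'|M. x_lin \<omega>')))"
    and "x_rec = (\<lambda>\<omega> k. Q_rec k \<bullet> (x_lin \<omega> - (LINT \<omega>'|M. x_lin \<omega>')))"
    and "\<rho> = spectral_norm r_aux r_rec (\<lambda>k l. Q_aux k \<bullet> Q_rec l)"
  shows "\<rho> \<in> {0..1} \<and>
    spectral_norm r_aux r_rec (cross_cov M x_aux x_rec)
      \<le> \<rho> * (spectral_norm r_aux r_aux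
                (\<lambda>k l. R_aux k \<bullet> ((\<Sigma>_u + (\<tau>\<^sup>2) *\<^sub>R mat 1) *v R_aux l))
             + spectral_norm r_rec r_rec (\<lambda>k l. R_rec k \<bullet> R_rec l)) \<and>
    ((\<forall>y \<in> range (\<lambda>v. J_aux *v v). \<forall>z \<in> range (\<lambda>v. J_rec *v v). orthogonal y z) \<longrightarrow>
      \<rho> = 0 \<and> (\<forall>k<r_aux. \<forall>l<r_rec. cross_cov M x_aux x_rec k l = 0))"
proof -
  interpret prob_space M by fact
  define S where "S = (\<lambda>k l. Q_aux k \<bullet> Q_rec l)"
  define w where "w = (\<lambda>\<omega>. z_aux \<omega> - m_u)"
  define K where "K = \<Sigma>_u + (\<tau>\<^sup>2) *\<^sub>R (mat 1 :: real^'d^'d)"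
  define A where "A = (\<lambda>k l. R_aux k \<bullet> (K *v R_aux l))"
  define B where "B = (\<lambda>k l. R_rec k \<bullet> R_rec l)"
  note qr = \<open>thin_qr r_aux Q_aux R_aux J_aux\<close> \<open>thin_qr r_rec Q_rec R_rec J_rec\<close>
  note indep = indep_triple_indep_set[OF \<open>indep_triple M u \<eta> z_rec\<close>]
  note u = centred_moments[OF \<open>u \<in> borel_measurable M\<close>
      \<open>integrable M (\<lambda>\<omega>. (norm (u \<omega>))\<^sup>2)\<close> \<open>m_u = (LINT \<omega>|M. u \<omega>)\<close>]
  note \<eta> = std_gaussian_mean[OF \<open>std_gaussian M \<eta>\<close>]
    std_gaussian_second_moment[OF \<open>std_gaussian M \<eta>\<close>]
  note z = std_gaussian_mean[OF \<open>std_gaussian M z_rec\<close>]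
    std_gaussian_second_moment[OF \<open>std_gaussian M z_rec\<close>]
  \<comment> \<open>Centring by the constant \<open>m_u\<close> is a Borel map and preserves
    independence; it makes the mixed moments below vanish.\<close>
  have u_indep: "indep_set (borel_events M (\<lambda>\<omega>. u \<omega> - m_u)) (borel_events M \<eta>)"
    "indep_set (borel_events M (\<lambda>\<omega>. u \<omega> - m_u)) (borel_events M z_rec)"
    by (rule indep_set_borel_events_comp[OF indep(1), where f = "\<lambda>x. x - m_u" and g = "\<lambda>x. x"]
        indep_set_borel_events_comp[OF indep(2), where f = "\<lambda>x. x - m_u" and g = "\<lambda>x. x"];
        simp)+
  have u\<eta>: "has_bochner_integral M (\<lambda>\<omega>. (u \<omega> - m_u) $ i * \<eta> \<omega> $ j) 0" for i j
    using indep_set_product_moment[OF u_indep(1) u(1) \<eta>(1)] by simp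
  have uz: "has_bochner_integral M (\<lambda>\<omega>. (u \<omega> - m_u) $ i * z_rec \<omega> $ j) 0" for i j
    using indep_set_product_moment[OF u_indep(2) u(1) z(1)] by simp
  have \<eta>z: "has_bochner_integral M (\<lambda>\<omega>. \<eta> \<omega> $ i * z_rec \<omega> $ j) 0" for i j
    using indep_set_product_moment[OF indep(3) \<eta>(1) z(1)] by simp
  have w_nth: "w \<omega> $ i = (u \<omega> - m_u) $ i + \<tau> * \<eta> \<omega> $ i" for \<omega> i
    using \<open>z_aux = _\<close> by (simp add: w_def)
  have "has_bochner_integral M (\<lambda>\<omega>. w \<omega> $ i) (0 + \<tau> * 0)" for i
    unfolding w_nth by (intro has_bochner_integral_add has_bochner_integral_mult_right u \<eta>)
  then have w0: "has_bochner_integral M (\<lambda>\<omega>. w \<omega> $ i) 0" for i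
    by simp
  \<comment> \<open>Expansion of \<open>w \<omega> $ i * w \<omega> $ j\<close>. The mixed terms
    vanish by independence, and the noise contributes \<open>\<tau>\<^sup>2\<close> times the
    identity, so the sum is \<open>K\<close>.\<close>
  have "has_bochner_integral M
      (\<lambda>\<omega>. ((u \<omega> - m_u) $ i * (u \<omega> - m_u) $ j + \<tau> * ((u \<omega> - m_u) $ i * \<eta> \<omega> $ j))
         + (\<tau> * ((u \<omega> - m_u) $ j * \<eta> \<omega> $ i) + \<tau>\<^sup>2 * (\<eta> \<omega> $ i * \<eta> \<omega> $ j)))
      ((cov_matrix M u $ i $ j + \<tau> * 0) + (\<tau> * 0 + \<tau>\<^sup>2 * mat 1 $ i $ j))" for i j
    by (intro has_bochner_integral_add has_bochner_integral_mult_right u u\<eta> \<eta>)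
  then have ww: "has_bochner_integral M (\<lambda>\<omega>. w \<omega> $ i * w \<omega> $ j) (K $ i $ j)" for i j
    unfolding w_nth K_def \<open>\<Sigma>_u = cov_matrix M u\<close>
    by (simp add: algebra_simps power2_eq_square)
  have "has_bochner_integral M (\<lambda>\<omega>. (u \<omega> - m_u) $ i * z_rec \<omega> $ j + \<tau> * (\<eta> \<omega> $ i * z_rec \<omega> $ j))
      (0 + \<tau> * 0)" for i j
    by (intro has_bochner_integral_add has_bochner_integral_mult_right uz \<eta>z)
  then have wz: "has_bochner_integral M (\<lambda>\<omega>. w \<omega> $ i * z_rec \<omega> $ j) 0" for i j
    unfolding w_nth by (simp add: algebra_simps)
  have x: "x_lin = (\<lambda>\<omega>. G (m_u, 0) + J_aux *v w \<omega> + J_rec *v z_rec \<omega>)"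
    unfolding w_def by fact
  \<comment> \<open>Entrywise, the cross covariance is \<open>A S + S B\<close>: every term contains
    \<open>S\<close> once, which produces the common factor \<open>\<rho>\<close>.\<close>
  have C: "cross_cov M x_aux x_rec k l = (\<Sum>i<r_aux. A k i * S i l) + (\<Sum>j<r_rec. S k j * B j l)"
    if "k < r_aux" "l < r_rec" for k l
    using cross_cov_linear[OF prob_space_axioms qr w0 z(1) ww wz z(2) x that]
    unfolding \<open>x_aux = _\<close> \<open>x_rec = _\<close> A_def B_def S_def .
  have \<rho>: "\<rho> = spectral_norm r_aux r_rec S"
    unfolding S_def by fact
  have "0 \<le> \<rho>" "\<rho> \<le> 1"
    using spectral_norm_nonneg[of r_aux r_rec S]
      spectral_norm_orthonormal_le_1[OF qr[THEN thin_qr_orthonormal]] by (simp_all add: \<rho> S_def)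
  moreover have "spectral_norm r_aux r_rec (cross_cov M x_aux x_rec)
      \<le> \<rho> * (spectral_norm r_aux r_aux A + spectral_norm r_rec r_rec B)"
  proof -
    have "spectral_norm r_aux r_rec (cross_cov M x_aux x_rec)
        = spectral_norm r_aux r_rec
            (\<lambda>k l. (\<Sum>i<r_aux. A k i * S i l) + (\<Sum>j<r_rec. S k j * B j l))"
      by (rule spectral_norm_cong) (rule C)
    also have "\<dots> \<le> spectral_norm r_aux r_rec (\<lambda>k l. \<Sum>i<r_aux. A k i * S i l)
        + spectral_norm r_aux r_rec (\<lambda>k l. \<Sum>j<r_rec. S k j * B j l)"
      by (rule spectral_norm_add_le)
    also have "\<dots> \<le> spectral_norm r_aux r_aux A * \<rho> + \<rho> * spectral_norm r_rec r_rec B"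
      unfolding \<rho> by (intro add_mono spectral_norm_mult_le)
    finally show ?thesis
      by (simp add: algebra_simps)
  qed
  moreover have "\<rho> = 0 \<and> (\<forall>k<r_aux. \<forall>l<r_rec. cross_cov M x_aux x_rec k l = 0)"
    if "\<forall>y \<in> range (\<lambda>v. J_aux *v v). \<forall>z \<in> range (\<lambda>v. J_rec *v v). orthogonal y z"
  proof -
    \<comment> \<open>The columns of the two \<open>Q\<close> factors lie in the orthogonal ranges.
      With \<open>S\<close> zero, \<open>C\<close> makes each covariance entry exactly zero.\<close>
    have S: "S k l = 0" if "k < r_aux" "l < r_rec" for k l
      using \<open>\<forall>y \<in> _. _\<close> thin_qr_in_range[OF qr(1) that(1)] thin_qr_in_range[OF qr(2) that(2)]
      unfolding S_def orthogonal_def by blast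
    have "\<rho> = spectral_norm r_aux r_rec (\<lambda>k l. 0)"
      unfolding \<rho> by (rule spectral_norm_cong) (rule S)
    then show ?thesis
      by (simp add: spectral_norm_zero C S)
  qed
  ultimately show ?thesis
    unfolding A_def B_def K_def by simp
qed

end
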